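(* Let $(X,\rho,\mu)$ be a space of homogeneous type and let $\mathscr D$ be a fixed system of dyadic cubes in $X$. Let $f\in L^1(X)$ with $\operatorname{supp}f\subset Q_0$, where $Q_0\in\mathscr D$. Define $\alpha_0:=\frac1{\mu(Q_0)}\int_{Q_0}|f|\,d\mu$ and define the dyadic maximal function $$Mf(x):=\sup_{Q\ni x,\;Q\in\mathscr D,\;Q\subset Q_0}\frac1{\mu(Q)}\int_Q|f(y)|\,d\mu(y),$$ the supremum being over all dyadic cubes $Q\in\mathscr D$ containing $x$ and included in $Q_0$. Let $\alpha>\alpha_0$ and $\Omega_\alpha:=\{x\in Q_0:Mf(x)>\alpha\}$. Then $\Omega_\alpha$ can be written as a disjoint union of dyadic cubes $\{Q_j\}$ with the following three properties. (i) For each cube $Q_j$, $$\alpha<\frac1{\mu(Q_j)}\int_{Q_j}|f(x)|\,d\mu(x)\le A_1^N\alpha,$$ where $A_1\ge1$ is the doubling constant of $\mu$ and $N:=1+\log_2(2A_0C_1/(c_1\delta))$. (ii) For $\mu$-a.e. $x\in X\setminus\bigcup_jQ_j$ we have $Mf(x)\le\alpha$. (iii) $\mu(\Omega_\alpha)\le\frac1\alpha\int_X|f(x)|\,d\mu(x)$.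
   Context: A quasimetric on a set $X$ is a function $\rho:X\times X\to[0,\infty)$ with $\rho(x,y)=0$ iff $x=y$, $\rho(x,y)=\rho(y,x)$, and $\rho(x,z)\le A_0\rho(x,y)+A_0\rho(y,z)$ for all $x,y,z$, where $A_0\ge1$ is the quasitriangle constant. $B(x,r)=\{y:\rho(x,y)<r\}$. A measure $\mu$ is doubling with doubling constant $A_1\ge1$ if balls are $\mu$-measurable and $0<\mu(B(x,2r))\le A_1\mu(B(x,r))<\infty$ for all $x\in X$, $r>0$. A space of homogeneous type is a triple $(X,\rho,\mu)$ with $X$ nonempty, $\rho$ a quasimetric, $\mu$ doubling; $\mu$ is defined on a $\sigma$-algebra containing all Borel sets (generated by sets $O$ such that each $x\in O$ has a ball $B(x,r)\subset O$) and all balls. A system of dyadic cubes with parameters $\delta\in(0,1)$ and $0<c_1<C_1<\infty$ is a countable family $\mathscr D=\bigcup_{k\in\mathbb Z}\mathscr D_k$, $\mathscr D_k=\{Q^k_\beta:\beta\in\mathscr A_k\}$, of Borel sets $Q^k_\beta\subset X$ with points $x^k_\beta\in Q^k_\beta$ such that: (1) for each $k$, $X$ is the disjoint union of the $Q^k_\beta$, $\beta\in\mathscr A_k$; (2) if $l\ge k$, then either $Q^l_\gamma\subset Q^k_\beta$ or $Q^k_\beta\cap Q^l_\gamma=\emptyset$; (3) $B(x^k_\beta,c_1\delta^k)\subset Q^k_\beta\subset B(x^k_\beta,C_1\delta^k)=:B(Q^k_\beta)$; (4) if $l\ge k$ and $Q^l_\gamma\subset Q^k_\beta$ then $B(Q^l_\gamma)\subset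 B(Q^k_\beta)$; (5) for each $(k,\beta)$ and each $l\le k$ there is a unique $\gamma$ with $Q^k_\beta\subset Q^l_\gamma$; (6) for each $(k,\beta)$ there are between $1$ and $M_0$ (a fixed constant) cubes $Q^{k+1}_\gamma\subset Q^k_\beta$, and $Q^k_\beta$ is the union of these. Convention: the fixed system $\mathscr D$ is one of the members of a collection $\{\mathscr D^t:t=1,\dots,T\}$ of adjacent systems of dyadic cubes on $X$, with parameters $0<\delta\le(96A_0^6)^{-1}$, $c_1=(12A_0^4)^{-1}$, $C_1=4A_0^2$; adjacency means that for each ball $B(x,r)$ with $\delta^{k+3}<r<\delta^{k+2}$ there are $t$ and a cube $Q\in\mathscr D^t$ of generation $k$ with center point $z$ such that $\rho(x,z)<2A_0\delta^k$ and $B(x,r)\subset Q\subset B(x,8A_0^3\delta^{-3}r)$. These $\delta,c_1,C_1$ are the ones appearing in $N$. *)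

theory Defs
  imports "HOL-Analysis.Analysis" "HOL-Library.Disjoint_Sets"
begin

definition qball :: "'a set \<Rightarrow> ('a \<Rightarrow> 'a \<Rightarrow> real) \<Rightarrow> 'a \<Rightarrow> real \<Rightarrow> 'a set" where
  "qball X \<rho> x r = {y \<in> X. \<rho> x y < r}"

text \<open>Balls of a quasimetric need not be open in this sense, nor even Borel.\<close>

definition qopen :: "'a set \<Rightarrow> ('a \<Rightarrow> 'a \<Rightarrow> real) \<Rightarrow> 'a set \<Rightarrow> bool" where
  "qopen X \<rho> U \<longleftrightarrow> U \<subseteq> X \<and> (\<forall>x\<in>U. \<exists>r>0. qball X \<rho> x r \<subseteq> U)"

definition qborel_sets :: "'a set \<Rightarrow> ('a \<Rightarrow> 'a \<Rightarrow> real) \<Rightarrow> 'a set set" where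
  "qborel_sets X \<rho> = sigma_sets X {U. qopen X \<rho> U}"

locale quasimetric_space =
  fixes X :: "'a set" and \<rho> :: "'a \<Rightarrow> 'a \<Rightarrow> real" and A\<^sub>0 :: real
  assumes A0_ge_1: "1 \<le> A\<^sub>0"
    and qm_nonneg: "\<And>x y. x \<in> X \<Longrightarrow> y \<in> X \<Longrightarrow> 0 \<le> \<rho> x y"
    and qm_eq_0_iff: "\<And>x y. x \<in> X \<Longrightarrow> y \<in> X \<Longrightarrow> \<rho> x y = 0 \<longleftrightarrow> x = y"
    and qm_sym: "\<And>x y. x \<in> X \<Longrightarrow> y \<in> X \<Longrightarrow> \<rho> x y = \<rho> y x"
    and qm_triangle: "\<And>x y z. x \<in> X \<Longrightarrow> y \<in> X \<Longrightarrow> z \<in> X \<Longrightarrow>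
      \<rho> x z \<le> A\<^sub>0 * \<rho> x y + A\<^sub>0 * \<rho> y z"

locale homogeneous_type_space = quasimetric_space X \<rho> A\<^sub>0
  for X :: "'a set" and \<rho> :: "'a \<Rightarrow> 'a \<Rightarrow> real" and A\<^sub>0 :: real +
  fixes \<mu> :: "'a measure" and A\<^sub>1 :: real
  assumes X_nonempty: "X \<noteq> {}"
    and space_mu: "space \<mu> = X"
    and qborel_in_sets: "qborel_sets X \<rho> \<subseteq> sets \<mu>"
    and qball_in_sets: "\<And>x r. x \<in> X \<Longrightarrow> 0 < r \<Longrightarrow> qball X \<rho> x r \<in> sets \<mu>"
    and A1_ge_1: "1 \<le> A\<^sub>1"
    and qball_pos: "\<And>x r. x \<in> X \<Longrightarrow> 0 < r \<Longrightarrow> 0 < emeasure \<mu> (qball X \<rho> x (2 * r))"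
    and doubling: "\<And>x r. x \<in> X \<Longrightarrow> 0 < r \<Longrightarrow>
      emeasure \<mu> (qball X \<rho> x (2 * r)) \<le> ennreal A\<^sub>1 * emeasure \<mu> (qball X \<rho> x r)"
    and qball_finite: "\<And>x r. x \<in> X \<Longrightarrow> 0 < r \<Longrightarrow>
      ennreal A\<^sub>1 * emeasure \<mu> (qball X \<rho> x r) < \<infinity>"

text \<open>
  The cube of generation \<open>k\<close> with index \<open>\<beta> \<in> I k\<close> is \<open>Q k \<beta>\<close>, and its center is \<open>c k \<beta>\<close>.
  The same set may be a cube of several generations, so the concentric ball
  is attached to the pair \<open>(k, \<beta>)\<close> and not to the set \<open>Q k \<beta>\<close>.
\<close>

locale dyadic_system =
  fixes X :: "'a set" and \<rho> :: "'a \<Rightarrow> 'a \<Rightarrow> real"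
    and \<delta> c\<^sub>1 C\<^sub>1 :: real and M\<^sub>0 :: nat
    and I :: "int \<Rightarrow> 'i set" and Q :: "int \<Rightarrow> 'i \<Rightarrow> 'a set" and c :: "int \<Rightarrow> 'i \<Rightarrow> 'a"
  assumes delta_pos: "0 < \<delta>" and delta_less_1: "\<delta> < 1"
    and c1_pos: "0 < c\<^sub>1" and c1_less_C1: "c\<^sub>1 < C\<^sub>1"
    and countable_index: "\<And>k. countable (I k)"
    and cube_borel: "\<And>k \<beta>. \<beta> \<in> I k \<Longrightarrow> Q k \<beta> \<in> qborel_sets X \<rho>"
    and center_in_cube: "\<And>k \<beta>. \<beta> \<in> I k \<Longrightarrow> c k \<beta> \<in> Q k \<beta>"
    and cover: "\<And>k. (\<Union>\<beta>\<in>I k. Q k \<beta>) = X"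
    and disjoint_gen: "\<And>k. disjoint_family_on (Q k) (I k)"
    and nested: "\<And>k l \<beta> \<gamma>. k \<le> l \<Longrightarrow> \<beta> \<in> I k \<Longrightarrow> \<gamma> \<in> I l \<Longrightarrow>
      Q l \<gamma> \<subseteq> Q k \<beta> \<or> Q k \<beta> \<inter> Q l \<gamma> = {}"
    and inner_ball: "\<And>k \<beta>. \<beta> \<in> I k \<Longrightarrow> qball X \<rho> (c k \<beta>) (c\<^sub>1 * \<delta> powi k) \<subseteq> Q k \<beta>"
    and outer_ball: "\<And>k \<beta>. \<beta> \<in> I k \<Longrightarrow> Q k \<beta> \<subseteq> qball X \<rho> (c k \<beta>) (C\<^sub>1 * \<delta> powi k)"
    and ball_nested: "\<And>k l \<beta> \<gamma>. k \<le> l \<Longrightarrow> \<beta> \<in> I k \<Longrightarrow> \<gamma> \<in> I l \<Longrightarrow> Q l \<gamma> \<subseteq> Q k \<beta> \<Longrightarrow>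
      qball X \<rho> (c l \<gamma>) (C\<^sub>1 * \<delta> powi l) \<subseteq> qball X \<rho> (c k \<beta>) (C\<^sub>1 * \<delta> powi k)"
    and ancestor: "\<And>k l \<beta>. l \<le> k \<Longrightarrow> \<beta> \<in> I k \<Longrightarrow> \<exists>!\<gamma>. \<gamma> \<in> I l \<and> Q k \<beta> \<subseteq> Q l \<gamma>"
    and children_card: "\<And>k \<beta>. \<beta> \<in> I k \<Longrightarrow>
      card {\<gamma> \<in> I (k + 1). Q (k + 1) \<gamma> \<subseteq> Q k \<beta>} \<in> {1..M\<^sub>0}"
    and children_union: "\<And>k \<beta>. \<beta> \<in> I k \<Longrightarrow>
      Q k \<beta> = (\<Union>\<gamma>\<in>{\<gamma> \<in> I (k + 1). Q (k + 1) \<gamma> \<subseteq> Q k \<beta>}. Q (k + 1) \<gamma>)"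

definition dyadic_cubes :: "(int \<Rightarrow> 'i set) \<Rightarrow> (int \<Rightarrow> 'i \<Rightarrow> 'a set) \<Rightarrow> 'a set set" where
  "dyadic_cubes I Q = (\<Union>k. Q k ` I k)"

text \<open>The systems are indexed by \<open>t \<in> {1..T}\<close>, and \<open>M\<^sub>0\<close> is common to all of them.\<close>

locale adjacent_dyadic_systems =
  fixes X :: "'a set" and \<rho> :: "'a \<Rightarrow> 'a \<Rightarrow> real"
    and A\<^sub>0 \<delta> c\<^sub>1 C\<^sub>1 :: real and M\<^sub>0 T :: nat
    and I :: "nat \<Rightarrow> int \<Rightarrow> 'i set" and Q :: "nat \<Rightarrow> int \<Rightarrow> 'i \<Rightarrow> 'a set"
    and c :: "nat \<Rightarrow> int \<Rightarrow> 'i \<Rightarrow> 'a"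
  assumes system: "\<And>t. t \<in> {1..T} \<Longrightarrow> dyadic_system X \<rho> \<delta> c\<^sub>1 C\<^sub>1 M\<^sub>0 (I t) (Q t) (c t)"
    and delta_le: "\<delta> \<le> 1 / (96 * A\<^sub>0 ^ 6)"
    and c1_eq: "c\<^sub>1 = 1 / (12 * A\<^sub>0 ^ 4)"
    and C1_eq: "C\<^sub>1 = 4 * A\<^sub>0 ^ 2"
    and adjacent: "\<And>x r k. x \<in> X \<Longrightarrow> \<delta> powi (k + 3) < r \<Longrightarrow> r < \<delta> powi (k + 2) \<Longrightarrow>
      \<exists>t\<in>{1..T}. \<exists>\<beta>\<in>I t k. \<rho> x (c t k \<beta>) < 2 * A\<^sub>0 * \<delta> powi k \<and>
        qball X \<rho> x r \<subseteq> Q t k \<beta> \<and>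
        Q t k \<beta> \<subseteq> qball X \<rho> x (8 * A\<^sub>0 ^ 3 * \<delta> powi (-3) * r)"

definition average :: "'a measure \<Rightarrow> ('a \<Rightarrow> complex) \<Rightarrow> 'a set \<Rightarrow> real" where
  "average \<mu> f E = 1 / measure \<mu> E * (LINT y:E|\<mu>. norm (f y))"

text \<open>
  The supremum may be infinite at some points, hence the values in \<^typ>\<open>ennreal\<close>. Outside \<open>Q\<^sub>0\<close>
  it is the supremum of the empty set, which is 0 there.
\<close>

definition dyadic_maximal ::
  "'a measure \<Rightarrow> 'a set set \<Rightarrow> 'a set \<Rightarrow> ('a \<Rightarrow> complex) \<Rightarrow> 'a \<Rightarrow> ennreal" where
  "dyadic_maximal \<mu> \<D> Q\<^sub>0 f x = (SUP R\<in>{R \<in> \<D>. x \<in> R \<and> R \<subseteq> Q\<^sub>0}. ennreal (average \<mu> f R))"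

text \<open>
  An element of \<open>L\<^sup>1\<close> is determined only up to null sets and dyadic cubes need not be closed,
  so \<open>supp f \<subseteq> E\<close> is read as: \<open>f\<close> vanishes almost everywhere outside \<open>E\<close>.
\<close>

definition supported_in :: "'a measure \<Rightarrow> ('a \<Rightarrow> complex) \<Rightarrow> 'a set \<Rightarrow> bool" where
  "supported_in \<mu> f E \<longleftrightarrow> (AE x in \<mu>. x \<notin> E \<longrightarrow> f x = 0)"

end

theory Submission
  imports Defs
begin

text \<open>
  This is the Calderon--Zygmund stopping-time argument. Every cube \<open>R \<subseteq> Q\<^sub>0\<close> on which the average
  of \<open>|f|\<close> exceeds \<open>\<alpha>\<close> lies in a strictly later generation than \<open>Q\<^sub>0\<close>, since a cube of
  the same or an earlier generation that is contained in \<open>Q\<^sub>0\<close> equals \<open>Q\<^sub>0\<close>, whose average is below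
  \<open>\<alpha>\<close>. So generations of such cubes are bounded below, and each point of \<open>\<Omega>\<close> lies in one of
  least generation; these are the stopping cubes. Two that meet are nested, and minimality of the
  generation forces them to be equal, so they are disjoint with union \<open>\<Omega>\<close>.

  The upper bound for the averages comes from the parent \<open>P\<close> of a stopping cube \<open>R\<close>. By minimality
  the average over \<open>P\<close> is at most \<open>\<alpha>\<close>, so the average over \<open>R\<close> is at most \<open>\<alpha> \<mu>(P) / \<mu>(R)\<close>. The
  quasitriangle inequality puts \<open>P\<close> inside a ball centred at the center of \<open>R\<close> whose radius is
  \<open>2 A\<^sub>0 C\<^sub>1 / (c\<^sub>1 \<delta>)\<close> times that of the inner ball of \<open>R\<close>, and iterated doubling bounds the ratio
  of measures by \<open>A\<^sub>1\<^sup>N\<close> (\<open>measure_parent_le\<close>).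

  Off the stopping cubes \<open>Mf \<le> \<alpha>\<close>: inside \<open>Q\<^sub>0\<close> by the definition of \<open>\<Omega>\<close>, and outside because the
  supremum is empty there. The estimate for \<open>\<mu>(\<Omega>)\<close> is Chebyshev's inequality on each stopping
  cube, summed over the disjoint cubes (\<open>emeasure_Union_le_nn_integral\<close>).
\<close>

section \<open>Averages and disjoint unions\<close>

lemma average_nonneg: "0 \<le> average \<mu> f E"
  unfolding average_def set_lebesgue_integral_def
  by (intro mult_nonneg_nonneg integral_nonneg_AE) auto

lemma average_times_measure:
  assumes "measure \<mu> E \<noteq> 0"
  shows "average \<mu> f E * measure \<mu> E = (LINT y:E|\<mu>. norm (f y))"
  using assms by (simp add: average_def)

lemma integrable_indicator_norm:
  fixes f :: "'a \<Rightarrow> complex"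
  assumes "integrable \<mu> f" "E \<in> sets \<mu>"
  shows "integrable \<mu> (\<lambda>y. indicator E y *\<^sub>R norm (f y))"
  using integrable_mult_indicator[OF assms(2) integrable_norm[OF assms(1)]] .

lemma set_integral_norm_mono:
  fixes f :: "'a \<Rightarrow> complex"
  assumes "integrable \<mu> f" "R \<in> sets \<mu>" "P \<in> sets \<mu>" "R \<subseteq> P"
  shows "(LINT y:R|\<mu>. norm (f y)) \<le> (LINT y:P|\<mu>. norm (f y))"
  unfolding set_lebesgue_integral_def
proof (rule integral_mono)
  show "integrable \<mu> (\<lambda>y. indicator R y *\<^sub>R norm (f y))"
    "integrable \<mu> (\<lambda>y. indicator P y *\<^sub>R norm (f y))"
    by (intro integrable_indicator_norm assms)+
  show "indicator R y *\<^sub>R norm (f y) \<le> indicator P y *\<^sub>R norm (f y)" for y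
    using assms(4) by (auto simp: indicator_def)
qed

text \<open>
  Weighting \<open>\<mu>\<close> by \<open>g\<close> gives a second measure, and both measures are countably additive, so the
  hypothesis on the single sets can be summed.
\<close>

lemma emeasure_Union_le_nn_integral:
  assumes g: "g \<in> borel_measurable \<mu>"
    and \<Q>: "countable \<Q>" "\<Q> \<subseteq> sets \<mu>" "disjoint \<Q>"
    and le: "\<And>R. R \<in> \<Q> \<Longrightarrow> a * emeasure \<mu> R \<le> (\<integral>\<^sup>+y\<in>R. g y \<partial>\<mu>)"
  shows "a * emeasure \<mu> (\<Union>\<Q>) \<le> (\<integral>\<^sup>+y. g y \<partial>\<mu>)"
proof -
  let ?\<nu> = "density \<mu> g"
  have disj: "disjoint_family_on (\<lambda>R. R) \<Q>"
    using \<Q>(3) by (auto simp: disjoint_family_on_def disjoint_def)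
  have U: "\<Union>\<Q> \<in> sets \<mu>"
    using \<Q> by (intro sets.countable_Union)
  have \<mu>: "emeasure \<mu> (\<Union>\<Q>) = (\<integral>\<^sup>+R. emeasure \<mu> R \<partial>count_space \<Q>)"
    using emeasure_UN_countable[of \<Q> "\<lambda>R. R" \<mu>] \<Q> disj by auto
  have \<nu>: "emeasure ?\<nu> (\<Union>\<Q>) = (\<integral>\<^sup>+R. emeasure ?\<nu> R \<partial>count_space \<Q>)"
    using emeasure_UN_countable[of \<Q> "\<lambda>R. R" ?\<nu>] \<Q> disj by auto
  have "a * emeasure \<mu> (\<Union>\<Q>) = (\<integral>\<^sup>+R. a * emeasure \<mu> R \<partial>count_space \<Q>)"
    unfolding \<mu> by (simp add: nn_integral_cmult)
  also have "\<dots> \<le> (\<integral>\<^sup>+R. emeasure ?\<nu> R \<partial>count_space \<Q>)"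
  proof (rule nn_integral_mono)
    fix R assume "R \<in> space (count_space \<Q>)"
    then have R: "R \<in> \<Q>" by simp
    with \<Q> have "R \<in> sets \<mu>" by auto
    with le[OF R] show "a * emeasure \<mu> R \<le> emeasure ?\<nu> R"
      by (simp add: emeasure_density g)
  qed
  also have "\<dots> = (\<integral>\<^sup>+y\<in>\<Union>\<Q>. g y \<partial>\<mu>)"
    using U by (simp add: \<nu>[symmetric] emeasure_density g)
  also have "\<dots> \<le> (\<integral>\<^sup>+y. g y \<partial>\<mu>)"
    by (intro nn_integral_mono) (auto simp: indicator_def)
  finally show ?thesis .
qed

lemma nn_integral_eq_set_integral_norm:
  fixes f :: "'a \<Rightarrow> complex"
  assumes "integrable \<mu> f" "R \<in> sets \<mu>"
  shows "(\<integral>\<^sup>+y\<in>R. ennreal (norm (f y)) \<partial>\<mu>) = ennreal (LINT y:R|\<mu>. norm (f y))"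
proof -
  have "(\<integral>\<^sup>+y\<in>R. ennreal (norm (f y)) \<partial>\<mu>) =
      (\<integral>\<^sup>+y. ennreal (indicator R y *\<^sub>R norm (f y)) \<partial>\<mu>)"
    by (intro nn_integral_cong) (auto simp: indicator_def)
  also have "\<dots> = ennreal (LINT y:R|\<mu>. norm (f y))"
    unfolding set_lebesgue_integral_def
    by (intro nn_integral_eq_integral integrable_indicator_norm assms) (auto simp: indicator_def)
  finally show ?thesis .
qed

section \<open>Balls and doubling\<close>

context homogeneous_type_space
begin

lemma emeasure_qball_pos:
  assumes "x \<in> X" "0 < r"
  shows "0 < emeasure \<mu> (qball X \<rho> x r)"
  using qball_pos[of x "r / 2"] assms by simp

lemma emeasure_qball_finite:
  assumes "x \<in> X" "0 < r"
  shows "emeasure \<mu> (qball X \<rho> x r) < \<infinity>"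
  using qball_finite[OF assms] A1_ge_1 by (auto simp: ennreal_mult_less_top)

lemma emeasure_qball_power:
  assumes "x \<in> X" "0 < r"
  shows "emeasure \<mu> (qball X \<rho> x (2 ^ n * r)) \<le> ennreal (A\<^sub>1 ^ n) * emeasure \<mu> (qball X \<rho> x r)"
proof (induction n)
  case (Suc n)
  have "emeasure \<mu> (qball X \<rho> x (2 ^ Suc n * r)) \<le>
      ennreal A\<^sub>1 * emeasure \<mu> (qball X \<rho> x (2 ^ n * r))"
    using doubling[of x "2 ^ n * r"] assms by (simp add: mult.assoc)
  also have "\<dots> \<le> ennreal A\<^sub>1 * (ennreal (A\<^sub>1 ^ n) * emeasure \<mu> (qball X \<rho> x r))"
    by (intro mult_left_mono Suc.IH) simp
  also have "\<dots> = ennreal (A\<^sub>1 ^ Suc n) * emeasure \<mu> (qball X \<rho> x r)"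
    using A1_ge_1 by (simp add: ennreal_mult mult.assoc)
  finally show ?case .
qed simp

text \<open>
  Rounding \<open>log\<^sub>2 t\<close> up to an integer number of doublings costs at most one extra factor \<open>A\<^sub>1\<close>,
  which is the summand 1 in the exponent.
\<close>

lemma emeasure_qball_scale:
  assumes "x \<in> X" "0 < r" "1 \<le> t"
  shows "emeasure \<mu> (qball X \<rho> x (t * r)) \<le>
    ennreal (A\<^sub>1 powr (1 + log 2 t)) * emeasure \<mu> (qball X \<rho> x r)"
proof -
  define n where "n = nat \<lceil>log 2 t\<rceil>"
  have log0: "0 \<le> log 2 t" using assms by simp
  have n: "log 2 t \<le> real n" "real n \<le> 1 + log 2 t"
    using log0 unfolding n_def by linarith+
  have "t = 2 powr (log 2 t)" using assms by simp
  also have "\<dots> \<le> 2 powr (real n)" by (rule powr_mono) (use n in auto)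
  finally have "t \<le> 2 ^ n" by (simp add: powr_realpow)
  then have tr: "t * r \<le> 2 ^ n * r"
    using assms by (intro mult_right_mono) auto
  have "emeasure \<mu> (qball X \<rho> x (t * r)) \<le> emeasure \<mu> (qball X \<rho> x (2 ^ n * r))"
    using tr assms by (intro emeasure_mono qball_in_sets) (auto simp: qball_def intro: less_le_trans)
  also have "\<dots> \<le> ennreal (A\<^sub>1 ^ n) * emeasure \<mu> (qball X \<rho> x r)"
    by (rule emeasure_qball_power) fact+
  also have "\<dots> \<le> ennreal (A\<^sub>1 powr (1 + log 2 t)) * emeasure \<mu> (qball X \<rho> x r)"
  proof (intro mult_right_mono ennreal_leI)
    have "A\<^sub>1 ^ n = A\<^sub>1 powr real n" using A1_ge_1 by (simp add: powr_realpow)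
    also have "\<dots> \<le> A\<^sub>1 powr (1 + log 2 t)" using n A1_ge_1 by (intro powr_mono) auto
    finally show "A\<^sub>1 ^ n \<le> A\<^sub>1 powr (1 + log 2 t)" .
  qed simp
  finally show ?thesis .
qed

end

section \<open>Dyadic cubes\<close>

context dyadic_system
begin

lemma cube_subset_space: "\<beta> \<in> I k \<Longrightarrow> Q k \<beta> \<subseteq> X"
  using cover[of k] by auto

lemma center_in_space: "\<beta> \<in> I k \<Longrightarrow> c k \<beta> \<in> X"
  using center_in_cube cube_subset_space by blast

lemma countable_dyadic_cubes: "countable (dyadic_cubes I Q)"
  unfolding dyadic_cubes_def using countable_index by (intro countable_UN countable_image) auto

lemma cubes_meet_subset:
  assumes "k \<le> l" "\<beta> \<in> I k" "\<gamma> \<in> I l" "x \<in> Q k \<beta>" "x \<in> Q l \<gamma>"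
  shows "Q l \<gamma> \<subseteq> Q k \<beta>"
  using nested[OF assms(1-3)] assms(4,5) by auto

lemma same_generation_eq:
  assumes "\<beta> \<in> I k" "\<gamma> \<in> I k" "x \<in> Q k \<beta>" "x \<in> Q k \<gamma>"
  shows "Q k \<beta> = Q k \<gamma>"
  using cubes_meet_subset[of k k \<beta> \<gamma> x] cubes_meet_subset[of k k \<gamma> \<beta> x] assms by auto

lemma earlier_subcube_eq:
  assumes "l \<le> k" "\<beta> \<in> I k" "\<gamma> \<in> I l" "Q l \<gamma> \<subseteq> Q k \<beta>"
  shows "Q l \<gamma> = Q k \<beta>"
  using cubes_meet_subset[OF assms(1,3,2), of "c l \<gamma>"] center_in_cube[OF assms(3)] assms(4) by auto

end

locale homogeneous_dyadic_space =
  homogeneous_type_space X \<rho> A\<^sub>0 \<mu> A\<^sub>1 + dyadic_system X \<rho> \<delta> c\<^sub>1 C\<^sub>1 M\<^sub>0 I Q c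
  for X :: "'a set" and \<rho> A\<^sub>0 and \<mu> :: "'a measure" and A\<^sub>1 \<delta> c\<^sub>1 C\<^sub>1 M\<^sub>0
    and I :: "int \<Rightarrow> 'i set" and Q c
begin

lemma radius_pos: "0 < c\<^sub>1 * \<delta> powi k" "0 < C\<^sub>1 * \<delta> powi k"
  using delta_pos c1_pos c1_less_C1 by auto

lemma cube_in_sets: "\<beta> \<in> I k \<Longrightarrow> Q k \<beta> \<in> sets \<mu>"
  using cube_borel qborel_in_sets by blast

lemma emeasure_cube_finite:
  assumes "\<beta> \<in> I k"
  shows "emeasure \<mu> (Q k \<beta>) < \<infinity>"
proof -
  have "emeasure \<mu> (Q k \<beta>) \<le> emeasure \<mu> (qball X \<rho> (c k \<beta>) (C\<^sub>1 * \<delta> powi k))"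
    using assms by (intro emeasure_mono outer_ball qball_in_sets center_in_space radius_pos)
  also have "\<dots> < \<infinity>"
    using assms by (intro emeasure_qball_finite center_in_space radius_pos)
  finally show ?thesis .
qed

lemma emeasure_cube: "\<beta> \<in> I k \<Longrightarrow> emeasure \<mu> (Q k \<beta>) = ennreal (measure \<mu> (Q k \<beta>))"
  using emeasure_cube_finite[of \<beta> k] by (intro emeasure_eq_ennreal_measure) auto

lemma measure_cube_pos:
  assumes "\<beta> \<in> I k"
  shows "0 < measure \<mu> (Q k \<beta>)"
proof -
  have "0 < emeasure \<mu> (qball X \<rho> (c k \<beta>) (c\<^sub>1 * \<delta> powi k))"
    using assms by (intro emeasure_qball_pos center_in_space radius_pos)
  also have "\<dots> \<le> emeasure \<mu> (Q k \<beta>)"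
    using assms by (intro emeasure_mono inner_ball cube_in_sets)
  finally show ?thesis
    using emeasure_cube[OF assms] by simp
qed

abbreviation parent_ratio :: real where
  "parent_ratio \<equiv> 2 * A\<^sub>0 * C\<^sub>1 / (c\<^sub>1 * \<delta>)"

lemma parent_ratio_ge_1: "1 \<le> parent_ratio"
proof -
  have "c\<^sub>1 * \<delta> \<le> c\<^sub>1 * 1" using delta_less_1 c1_pos by (intro mult_left_mono) auto
  also have "\<dots> \<le> 1 * C\<^sub>1" using c1_less_C1 by simp
  also have "\<dots> \<le> 2 * A\<^sub>0 * C\<^sub>1" using A0_ge_1 c1_pos c1_less_C1 by (intro mult_right_mono) auto
  finally show ?thesis using c1_pos delta_pos by (simp add: field_simps)
qed

text \<open>
  Both the center of \<open>R\<close> and any point of its parent lie in the outer ball of the parent, so their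
  distance is less than \<open>2 A\<^sub>0 C\<^sub>1 \<delta>\<^sup>l / \<delta>\<close>, where \<open>l\<close> is the generation of \<open>R\<close>.
\<close>

lemma measure_parent_le:
  assumes \<beta>: "\<beta> \<in> I l" and \<gamma>: "\<gamma> \<in> I (l - 1)" and sub: "Q l \<beta> \<subseteq> Q (l - 1) \<gamma>"
  shows "measure \<mu> (Q (l - 1) \<gamma>) \<le> A\<^sub>1 powr (1 + log 2 parent_ratio) * measure \<mu> (Q l \<beta>)"
proof -
  let ?x = "c l \<beta>" and ?z = "c (l - 1) \<gamma>" and ?r = "C\<^sub>1 * \<delta> powi (l - 1)"
  have x: "?x \<in> X" and z: "?z \<in> X" using \<beta> \<gamma> by (auto intro: center_in_space)
  have radius: "A\<^sub>0 * ?r + A\<^sub>0 * ?r = parent_ratio * (c\<^sub>1 * \<delta> powi l)"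
    using delta_pos c1_pos by (simp add: power_int_diff field_simps)
  have xz: "\<rho> ?x ?z < ?r"
    using outer_ball[OF \<gamma>] sub center_in_cube[OF \<beta>] qm_sym[OF x z] by (auto simp: qball_def)
  have "Q (l - 1) \<gamma> \<subseteq> qball X \<rho> ?x (parent_ratio * (c\<^sub>1 * \<delta> powi l))"
  proof
    fix y assume "y \<in> Q (l - 1) \<gamma>"
    then have y: "y \<in> X" "\<rho> ?z y < ?r" using outer_ball[OF \<gamma>] by (auto simp: qball_def)
    have "\<rho> ?x y \<le> A\<^sub>0 * \<rho> ?x ?z + A\<^sub>0 * \<rho> ?z y" using x z y(1) by (rule qm_triangle)
    also have "\<dots> < A\<^sub>0 * ?r + A\<^sub>0 * ?r"
      using A0_ge_1 xz y(2) by (intro add_strict_mono mult_strict_left_mono) auto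
    finally show "y \<in> qball X \<rho> ?x (parent_ratio * (c\<^sub>1 * \<delta> powi l))"
      unfolding radius using y(1) by (simp add: qball_def)
  qed
  then have "emeasure \<mu> (Q (l - 1) \<gamma>) \<le>
      emeasure \<mu> (qball X \<rho> ?x (parent_ratio * (c\<^sub>1 * \<delta> powi l)))"
    using parent_ratio_ge_1
    by (intro emeasure_mono qball_in_sets x mult_pos_pos[OF _ radius_pos(1)]) linarith+
  also have "\<dots> \<le> ennreal (A\<^sub>1 powr (1 + log 2 parent_ratio)) *
      emeasure \<mu> (qball X \<rho> ?x (c\<^sub>1 * \<delta> powi l))"
    by (intro emeasure_qball_scale x radius_pos parent_ratio_ge_1)
  also have "\<dots> \<le> ennreal (A\<^sub>1 powr (1 + log 2 parent_ratio)) * emeasure \<mu> (Q l \<beta>)"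
    using \<beta> by (intro mult_left_mono emeasure_mono inner_ball cube_in_sets) auto
  finally show ?thesis
    by (simp add: emeasure_cube \<beta> \<gamma> ennreal_mult[symmetric])
qed

lemma average_le_parent_average:
  assumes f: "integrable \<mu> f"
    and \<beta>: "\<beta> \<in> I l" and \<gamma>: "\<gamma> \<in> I (l - 1)" and sub: "Q l \<beta> \<subseteq> Q (l - 1) \<gamma>"
  shows "average \<mu> f (Q l \<beta>) \<le>
    A\<^sub>1 powr (1 + log 2 parent_ratio) * average \<mu> f (Q (l - 1) \<gamma>)"
proof -
  let ?R = "Q l \<beta>" and ?P = "Q (l - 1) \<gamma>"
  let ?K = "A\<^sub>1 powr (1 + log 2 parent_ratio)"
  note pos = measure_cube_pos[OF \<beta>] measure_cube_pos[OF \<gamma>]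
  have "average \<mu> f ?R * measure \<mu> ?R \<le> average \<mu> f ?P * measure \<mu> ?P"
    using set_integral_norm_mono[OF f cube_in_sets[OF \<beta>] cube_in_sets[OF \<gamma>] sub] pos
    by (simp add: average_times_measure)
  also have "\<dots> \<le> average \<mu> f ?P * (?K * measure \<mu> ?R)"
    by (intro mult_left_mono measure_parent_le assms average_nonneg)
  finally have "average \<mu> f ?R * measure \<mu> ?R \<le> (?K * average \<mu> f ?P) * measure \<mu> ?R"
    by (simp add: mult_ac)
  then show ?thesis using pos(1) by simp
qed

section \<open>Stopping cubes\<close>

text \<open>
  The stopping rule compares generations and not sets, because a set can be a cube of several
  generations. Ancestors are tested only from generation \<open>k\<^sub>0\<close>, that of \<open>Q\<^sub>0\<close>, on: these
  are the ones inside \<open>Q\<^sub>0\<close>.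
\<close>

definition stopping_cubes :: "('a \<Rightarrow> complex) \<Rightarrow> real \<Rightarrow> int \<Rightarrow> 'a set \<Rightarrow> 'a set set" where
  "stopping_cubes f \<alpha> k\<^sub>0 Q\<^sub>0 = {Q l \<beta> | l \<beta>. k\<^sub>0 < l \<and> \<beta> \<in> I l \<and> Q l \<beta> \<subseteq> Q\<^sub>0 \<and> \<alpha> < average \<mu> f (Q l \<beta>) \<and>
     (\<forall>m \<gamma>. k\<^sub>0 \<le> m \<longrightarrow> m < l \<longrightarrow> \<gamma> \<in> I m \<longrightarrow> Q l \<beta> \<subseteq> Q m \<gamma> \<longrightarrow> average \<mu> f (Q m \<gamma>) \<le> \<alpha>)}"

lemma stopping_cubesE:
  assumes "R \<in> stopping_cubes f \<alpha> k\<^sub>0 Q\<^sub>0"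
  obtains l \<beta> where "R = Q l \<beta>" "k\<^sub>0 < l" "\<beta> \<in> I l" "Q l \<beta> \<subseteq> Q\<^sub>0" "\<alpha> < average \<mu> f (Q l \<beta>)"
    "\<And>m \<gamma>. k\<^sub>0 \<le> m \<Longrightarrow> m < l \<Longrightarrow> \<gamma> \<in> I m \<Longrightarrow> Q l \<beta> \<subseteq> Q m \<gamma> \<Longrightarrow> average \<mu> f (Q m \<gamma>) \<le> \<alpha>"
  using assms unfolding stopping_cubes_def by blast

lemma stopping_cubes_subset_dyadic: "stopping_cubes f \<alpha> k\<^sub>0 Q\<^sub>0 \<subseteq> dyadic_cubes I Q"
  unfolding stopping_cubes_def dyadic_cubes_def by blast

lemma countable_stopping_cubes: "countable (stopping_cubes f \<alpha> k\<^sub>0 Q\<^sub>0)"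
  using stopping_cubes_subset_dyadic countable_dyadic_cubes by (rule countable_subset)

text \<open>
  If two stopping cubes of different generations met, the earlier one would contain the later one
  and, having a large average, would have prevented it from being selected.
\<close>

lemma disjoint_stopping_cubes: "disjoint (stopping_cubes f \<alpha> k\<^sub>0 Q\<^sub>0)"
proof (rule disjointI)
  fix R S
  assume R: "R \<in> stopping_cubes f \<alpha> k\<^sub>0 Q\<^sub>0" and S: "S \<in> stopping_cubes f \<alpha> k\<^sub>0 Q\<^sub>0" and "R \<noteq> S"
  show "R \<inter> S = {}"
  proof (rule ccontr)
    assume "R \<inter> S \<noteq> {}"
    then obtain x where x: "x \<in> R" "x \<in> S" by auto
    from R obtain l \<beta> where l: "R = Q l \<beta>" "k\<^sub>0 < l" "\<beta> \<in> I l" "\<alpha> < average \<mu> f (Q l \<beta>)"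
      "\<And>m \<gamma>. k\<^sub>0 \<le> m \<Longrightarrow> m < l \<Longrightarrow> \<gamma> \<in> I m \<Longrightarrow> Q l \<beta> \<subseteq> Q m \<gamma> \<Longrightarrow> average \<mu> f (Q m \<gamma>) \<le> \<alpha>"
      by (rule stopping_cubesE) blast
    from S obtain m \<gamma> where m: "S = Q m \<gamma>" "k\<^sub>0 < m" "\<gamma> \<in> I m" "\<alpha> < average \<mu> f (Q m \<gamma>)"
      "\<And>l \<beta>. k\<^sub>0 \<le> l \<Longrightarrow> l < m \<Longrightarrow> \<beta> \<in> I l \<Longrightarrow> Q m \<gamma> \<subseteq> Q l \<beta> \<Longrightarrow> average \<mu> f (Q l \<beta>) \<le> \<alpha>"
      by (rule stopping_cubesE) blast
    consider "l < m" | "l = m" | "m < l" by linarith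
    then show False
    proof cases
      case 1
      with x l m have "Q m \<gamma> \<subseteq> Q l \<beta>" by (intro cubes_meet_subset[of l m \<beta> \<gamma> x]) auto
      with m(5)[of l \<beta>] l 1 show False by auto
    next
      case 2
      with x l m \<open>R \<noteq> S\<close> same_generation_eq[of \<beta> l \<gamma> x] show False by auto
    next
      case 3
      with x l m have "Q l \<beta> \<subseteq> Q m \<gamma>" by (intro cubes_meet_subset[of m l \<gamma> \<beta> x]) auto
      with l(5)[of m \<gamma>] m 3 show False by auto
    qed
  qed
qed

text \<open>
  A cube inside \<open>Q\<^sub>0\<close> with average above \<open>\<alpha>\<close> has generation above \<open>k\<^sub>0\<close>, so among those
  containing a given point there is one of least generation.
\<close>

lemma Union_stopping_cubes:
  assumes \<beta>\<^sub>0: "\<beta>\<^sub>0 \<in> I k\<^sub>0" and Q0: "Q\<^sub>0 = Q k\<^sub>0 \<beta>\<^sub>0" and \<alpha>: "average \<mu> f Q\<^sub>0 < \<alpha>"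
  shows "\<Union>(stopping_cubes f \<alpha> k\<^sub>0 Q\<^sub>0) =
    {x \<in> Q\<^sub>0. ennreal \<alpha> < dyadic_maximal \<mu> (dyadic_cubes I Q) Q\<^sub>0 f x}"
proof -
  have \<alpha>0: "0 \<le> \<alpha>" using average_nonneg[of \<mu> f Q\<^sub>0] \<alpha> by simp
  have maximal_iff: "ennreal \<alpha> < dyadic_maximal \<mu> (dyadic_cubes I Q) Q\<^sub>0 f x \<longleftrightarrow>
      (\<exists>l. \<exists>\<beta>\<in>I l. x \<in> Q l \<beta> \<and> Q l \<beta> \<subseteq> Q\<^sub>0 \<and> \<alpha> < average \<mu> f (Q l \<beta>))" for x
    unfolding dyadic_maximal_def less_SUP_iff dyadic_cubes_def
    using \<alpha>0 by (auto simp: ennreal_less_iff)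
  have "x \<in> \<Union>(stopping_cubes f \<alpha> k\<^sub>0 Q\<^sub>0)"
    if ex: "\<exists>l. \<exists>\<beta>\<in>I l. x \<in> Q l \<beta> \<and> Q l \<beta> \<subseteq> Q\<^sub>0 \<and> \<alpha> < average \<mu> f (Q l \<beta>)" for x
  proof -
    define bad where
      "bad l \<beta> \<longleftrightarrow> \<beta> \<in> I l \<and> x \<in> Q l \<beta> \<and> Q l \<beta> \<subseteq> Q\<^sub>0 \<and> \<alpha> < average \<mu> f (Q l \<beta>)" for l \<beta>
    have later: "k\<^sub>0 < l" if "bad l \<beta>" for l \<beta>
    proof (rule ccontr)
      assume "\<not> k\<^sub>0 < l"
      then have "Q l \<beta> = Q\<^sub>0"
        using that earlier_subcube_eq[of l k\<^sub>0 \<beta>\<^sub>0 \<beta>] \<beta>\<^sub>0 by (auto simp: bad_def Q0)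
      with that \<alpha> show False by (simp add: bad_def)
    qed
    (* Generations are integers; offsets from k0 are naturals, where a least one exists. *)
    define n where "n = (LEAST n. \<exists>\<beta>. bad (k\<^sub>0 + int n) \<beta>)"
    from ex obtain l \<beta>' where "bad l \<beta>'" by (auto simp: bad_def)
    with later[of l \<beta>'] have "\<exists>\<beta>. bad (k\<^sub>0 + int (nat (l - k\<^sub>0))) \<beta>" by auto
    then have "\<exists>\<beta>. bad (k\<^sub>0 + int n) \<beta>" unfolding n_def by (rule LeastI)
    then obtain \<beta> where \<beta>: "bad (k\<^sub>0 + int n) \<beta>" by blast
    have "average \<mu> f (Q m \<gamma>) \<le> \<alpha>"
      if m: "k\<^sub>0 \<le> m" "m < k\<^sub>0 + int n" "\<gamma> \<in> I m" "Q (k\<^sub>0 + int n) \<beta> \<subseteq> Q m \<gamma>" for m \<gamma>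
    proof (rule ccontr)
      assume big: "\<not> average \<mu> f (Q m \<gamma>) \<le> \<alpha>"
      have x: "x \<in> Q m \<gamma>" "x \<in> Q\<^sub>0" using \<beta> m(4) by (auto simp: bad_def)
      then have "Q m \<gamma> \<subseteq> Q\<^sub>0" using cubes_meet_subset[OF m(1) \<beta>\<^sub>0 m(3)] by (simp add: Q0)
      with x big m have "bad (k\<^sub>0 + int (nat (m - k\<^sub>0))) \<gamma>" by (simp add: bad_def)
      then have "n \<le> nat (m - k\<^sub>0)" unfolding n_def by (blast intro: Least_le)
      with m show False by simp
    qed
    with \<beta> later[OF \<beta>] have "Q (k\<^sub>0 + int n) \<beta> \<in> stopping_cubes f \<alpha> k\<^sub>0 Q\<^sub>0"
      unfolding stopping_cubes_def bad_def by blast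
    with \<beta> show ?thesis by (auto simp: bad_def)
  qed
  moreover have "x \<in> Q\<^sub>0 \<and> (\<exists>l. \<exists>\<beta>\<in>I l. x \<in> Q l \<beta> \<and> Q l \<beta> \<subseteq> Q\<^sub>0 \<and> \<alpha> < average \<mu> f (Q l \<beta>))"
    if "x \<in> \<Union>(stopping_cubes f \<alpha> k\<^sub>0 Q\<^sub>0)" for x
    using that unfolding stopping_cubes_def by blast
  ultimately show ?thesis unfolding maximal_iff by blast
qed

text \<open>
  For the upper bound: the parent of a stopping cube has generation at least \<open>k\<^sub>0\<close>, so the stopping rule applies to it.
\<close>

lemma average_stopping_cube:
  assumes f: "integrable \<mu> f" and R: "R \<in> stopping_cubes f \<alpha> k\<^sub>0 Q\<^sub>0"
  shows "\<alpha> < average \<mu> f R" "average \<mu> f R \<le> A\<^sub>1 powr (1 + log 2 parent_ratio) * \<alpha>"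
proof -
  from R obtain l \<beta> where l: "R = Q l \<beta>" "k\<^sub>0 < l" "\<beta> \<in> I l" "\<alpha> < average \<mu> f (Q l \<beta>)"
    "\<And>m \<gamma>. k\<^sub>0 \<le> m \<Longrightarrow> m < l \<Longrightarrow> \<gamma> \<in> I m \<Longrightarrow> Q l \<beta> \<subseteq> Q m \<gamma> \<Longrightarrow> average \<mu> f (Q m \<gamma>) \<le> \<alpha>"
    by (rule stopping_cubesE) blast
  show "\<alpha> < average \<mu> f R" using l by simp
  obtain \<gamma> where \<gamma>: "\<gamma> \<in> I (l - 1)" "Q l \<beta> \<subseteq> Q (l - 1) \<gamma>"
    using ancestor[of "l - 1" l \<beta>] l(3) by auto
  have "average \<mu> f R \<le> A\<^sub>1 powr (1 + log 2 parent_ratio) * average \<mu> f (Q (l - 1) \<gamma>)"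
    unfolding l(1) by (intro average_le_parent_average f l \<gamma>)
  also have "\<dots> \<le> A\<^sub>1 powr (1 + log 2 parent_ratio) * \<alpha>"
    using l(2) \<gamma> by (intro mult_left_mono l(5)) auto
  finally show "average \<mu> f R \<le> A\<^sub>1 powr (1 + log 2 parent_ratio) * \<alpha>" .
qed

lemma emeasure_Union_stopping_cubes_le:
  assumes f: "integrable \<mu> f" and \<alpha>: "0 < \<alpha>"
  shows "emeasure \<mu> (\<Union>(stopping_cubes f \<alpha> k\<^sub>0 Q\<^sub>0)) \<le> ennreal (1 / \<alpha> * (\<integral>x. norm (f x) \<partial>\<mu>))"
proof -
  let ?\<Q> = "stopping_cubes f \<alpha> k\<^sub>0 Q\<^sub>0"
  have single: "ennreal \<alpha> * emeasure \<mu> R \<le> (\<integral>\<^sup>+y\<in>R. ennreal (norm (f y)) \<partial>\<mu>)"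
    and R_sets: "R \<in> sets \<mu>" if "R \<in> ?\<Q>" for R
  proof -
    from that obtain l \<beta> where l: "R = Q l \<beta>" "\<beta> \<in> I l" "\<alpha> < average \<mu> f (Q l \<beta>)"
      by (rule stopping_cubesE) blast
    show R: "R \<in> sets \<mu>" unfolding l(1) by (rule cube_in_sets) fact
    have "\<alpha> * measure \<mu> R \<le> average \<mu> f R * measure \<mu> R"
      using l by (intro mult_right_mono) auto
    also have "\<dots> = (LINT y:R|\<mu>. norm (f y))"
      using measure_cube_pos[OF l(2)] by (simp add: average_times_measure l(1))
    finally have "ennreal (\<alpha> * measure \<mu> R) \<le> (\<integral>\<^sup>+y\<in>R. ennreal (norm (f y)) \<partial>\<mu>)"
      unfolding nn_integral_eq_set_integral_norm[OF f R] by (rule ennreal_leI)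
    then show "ennreal \<alpha> * emeasure \<mu> R \<le> (\<integral>\<^sup>+y\<in>R. ennreal (norm (f y)) \<partial>\<mu>)"
      using \<alpha> emeasure_cube[OF l(2)] by (simp add: l(1) ennreal_mult)
  qed
  have "ennreal \<alpha> * emeasure \<mu> (\<Union>?\<Q>) \<le> (\<integral>\<^sup>+y. ennreal (norm (f y)) \<partial>\<mu>)"
    using f R_sets
    by (intro emeasure_Union_le_nn_integral single countable_stopping_cubes
        disjoint_stopping_cubes) auto
  also have "\<dots> = ennreal (\<integral>y. norm (f y) \<partial>\<mu>)"
    using f by (intro nn_integral_eq_integral) auto
  finally have "ennreal (1 / \<alpha>) * (ennreal \<alpha> * emeasure \<mu> (\<Union>?\<Q>)) \<le>
      ennreal (1 / \<alpha>) * ennreal (\<integral>y. norm (f y) \<partial>\<mu>)"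
    by (rule mult_left_mono) simp
  moreover have "ennreal (1 / \<alpha>) * (ennreal \<alpha> * emeasure \<mu> (\<Union>?\<Q>)) = emeasure \<mu> (\<Union>?\<Q>)"
    using \<alpha> by (simp add: mult.assoc[symmetric] ennreal_mult[symmetric])
  ultimately show ?thesis using \<alpha> by (simp add: ennreal_mult[symmetric])
qed

end

section \<open>The decomposition\<close>

theorem theorem3p1:
  fixes X :: "'a set" and \<rho> :: "'a \<Rightarrow> 'a \<Rightarrow> real" and \<mu> :: "'a measure"
    and A\<^sub>0 A\<^sub>1 \<delta> c\<^sub>1 C\<^sub>1 N \<alpha>\<^sub>0 \<alpha> :: real and M\<^sub>0 T t\<^sub>0 :: nat
    and I :: "nat \<Rightarrow> int \<Rightarrow> 'i set" and Q :: "nat \<Rightarrow> int \<Rightarrow> 'i \<Rightarrow> 'a set"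
    and c :: "nat \<Rightarrow> int \<Rightarrow> 'i \<Rightarrow> 'a"
    and \<D> :: "'a set set" and Q\<^sub>0 \<Omega> :: "'a set"
    and f :: "'a \<Rightarrow> complex" and Mf :: "'a \<Rightarrow> ennreal"
  assumes "homogeneous_type_space X \<rho> A\<^sub>0 \<mu> A\<^sub>1"
    and "adjacent_dyadic_systems X \<rho> A\<^sub>0 \<delta> c\<^sub>1 C\<^sub>1 M\<^sub>0 T I Q c"
    and "t\<^sub>0 \<in> {1..T}"
    and "\<D> = dyadic_cubes (I t\<^sub>0) (Q t\<^sub>0)"
    and "Q\<^sub>0 \<in> \<D>"
    and "integrable \<mu> f"
    and "supported_in \<mu> f Q\<^sub>0"
    and "\<alpha>\<^sub>0 = average \<mu> f Q\<^sub>0"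
    and "Mf = dyadic_maximal \<mu> \<D> Q\<^sub>0 f"
    and "\<alpha> > \<alpha>\<^sub>0"
    and "\<Omega> = {x \<in> Q\<^sub>0. Mf x > ennreal \<alpha>}"
    and "N = 1 + log 2 (2 * A\<^sub>0 * C\<^sub>1 / (c\<^sub>1 * \<delta>))"
  shows "\<exists>\<Q>. \<Q> \<subseteq> \<D> \<and> disjoint \<Q> \<and> \<Omega> = \<Union>\<Q> \<and>
    (\<forall>R\<in>\<Q>. \<alpha> < average \<mu> f R \<and> average \<mu> f R \<le> A\<^sub>1 powr N * \<alpha>) \<and>
    (AE x in \<mu>. x \<notin> \<Union>\<Q> \<longrightarrow> Mf x \<le> ennreal \<alpha>) \<and>
    emeasure \<mu> \<Omega> \<le> ennreal (1 / \<alpha> * (\<integral>x. norm (f x) \<partial>\<mu>))"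
proof -
  interpret adj: adjacent_dyadic_systems X \<rho> A\<^sub>0 \<delta> c\<^sub>1 C\<^sub>1 M\<^sub>0 T I Q c by fact
  interpret homogeneous_dyadic_space X \<rho> A\<^sub>0 \<mu> A\<^sub>1 \<delta> c\<^sub>1 C\<^sub>1 M\<^sub>0 "I t\<^sub>0" "Q t\<^sub>0" "c t\<^sub>0"
    unfolding homogeneous_dyadic_space_def using assms(1) adj.system[OF assms(3)] by blast
  obtain k\<^sub>0 \<beta>\<^sub>0 where Q0: "\<beta>\<^sub>0 \<in> I t\<^sub>0 k\<^sub>0" "Q\<^sub>0 = Q t\<^sub>0 k\<^sub>0 \<beta>\<^sub>0"
    using assms(4,5) by (auto simp: dyadic_cubes_def)
  have \<alpha>: "average \<mu> f Q\<^sub>0 < \<alpha>" using assms by simp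
  then have \<alpha>_pos: "0 < \<alpha>" using average_nonneg[of \<mu> f Q\<^sub>0] by simp
  let ?\<Q> = "stopping_cubes f \<alpha> k\<^sub>0 Q\<^sub>0"
  have \<Omega>: "\<Omega> = \<Union>?\<Q>"
    using Union_stopping_cubes[OF Q0 \<alpha>] assms by simp
  (* Outside Q0 no cube competes in the supremum, so the maximal function vanishes there. *)
  have outside: "Mf x \<le> ennreal \<alpha>" if "x \<notin> \<Omega>" for x
  proof (cases "x \<in> Q\<^sub>0")
    case True
    with that show ?thesis using assms(11) by (auto simp: not_less)
  next
    case False
    then have "{R \<in> \<D>. x \<in> R \<and> R \<subseteq> Q\<^sub>0} = {}" by auto
    then show ?thesis unfolding assms(9) dyadic_maximal_def by (simp only:) simp
  qed
  show ?thesis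
  proof (intro exI[of _ ?\<Q>] conjI ballI)
    show "?\<Q> \<subseteq> \<D>" using stopping_cubes_subset_dyadic assms(4) by simp
    show "disjoint ?\<Q>" by (rule disjoint_stopping_cubes)
    show "\<Omega> = \<Union>?\<Q>" by (rule \<Omega>)
    show "\<alpha> < average \<mu> f R" "average \<mu> f R \<le> A\<^sub>1 powr N * \<alpha>" if "R \<in> ?\<Q>" for R
      using average_stopping_cube[OF assms(6) that] assms(12) by simp_all
    show "AE x in \<mu>. x \<notin> \<Union>?\<Q> \<longrightarrow> Mf x \<le> ennreal \<alpha>"
      using outside unfolding \<Omega> by (intro AE_I2) blast
    show "emeasure \<mu> \<Omega> \<le> ennreal (1 / \<alpha> * (\<integral>x. norm (f x) \<partial>\<mu>))"
      unfolding \<Omega> by (rule emeasure_Union_stopping_cubes_le[OF assms(6) \<alpha>_pos])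
  qed
qed

end
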